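(* Let $S=\{s_1,\dots,s_n\}$ be a dataset and $f(x)=\frac1n\sum_{i=1}^n f(x,s_i)$ on $\mathbb{R}^d$, where $f$ is differentiable with $G$-Lipschitz gradient, attains its minimum, and $D_f\ge f(x_1)-\min_x f(x)$ for a fixed initial point $x_1$. Let $c>0$, $\epsilon>0$, $\delta\in(0,1)$, $m\in\{1,\dots,n\}$. DP-SGD with gradient clipping performs $$x_{t+1}=x_t-\alpha\Big(\frac1m\sum_{i\in S_t}\mathrm{clip}(\nabla f(x_t)+\xi_{t,i},c)+Z_t\Big),\qquad t=1,\dots,T,$$ where $\xi_{t,i}=\nabla f(x_t,s_i)-\nabla f(x_t)$, $S_t$ is a random subsample of $S$ of size $m$ drawn with replacement, and $Z_t\sim\mathcal N(0,\sigma^2I)$ is independent noise. Let $p_t$ be the uniform (empirical) distribution on $\{\xi_{t,1},\dots,\xi_{t,n}\}$ and, for each $t$, let $\tilde p_t$ be any distribution on $\mathbb{R}^d$ symmetric under $\xi\mapsto-\xi$. Then there exist constants $u,v>0$ such that for any $\epsilon\le u\frac{m^2}{n^2}T$, with $\sigma^2=v\frac{c^2T\ln(1/\delta)}{n^2\epsilon^2}$, $\alpha=\frac{\sqrt{D_fd\ln(1/\delta)}}{n\epsilon c\sqrt G}$ and $T=\frac{n^2\epsilon^2}{d\ln(1/\delta)}$, $$\frac1T\sum_{t=1}^T\mathbb{E}\Big[\mathbb{P}_{\xi\sim\tilde p_t}\left(\|\xi\|<\frac c4\right)h_c(\|\nabla f(x_t)\|)\Big]\le\left(\frac12v+\frac32\right)c\frac{\sqrt{D_fGd\ln(1/\delta)}}{n\epsilon}+\frac1T\sum_{t=1}^T\mathbb{E}\big[W_{\nabla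 f(x_t),c}(\tilde p_t,p_t)\big].$$
   Context: For $g\in\mathbb{R}^d$ and $c>0$, $\mathrm{clip}(g,c)=g\cdot\min\left(1,\frac{c}{\|g\|}\right)$ (with $\mathrm{clip}(0,c)=0$). $G$-Lipschitz gradient means $\|\nabla f(x)-\nabla f(y)\|\le G\|x-y\|$. $h_c(y)=\min(y^2,\frac34cy)$. For $w\in\mathbb{R}^d$, $d_{w,c}(a,b)=|\langle w,\mathrm{clip}(w+a,c)\rangle-\langle w,\mathrm{clip}(w+b,c)\rangle|$, and $W_{w,c}(p,p')=\inf_{\gamma\in\Gamma(p,p')}\int\!\!\int d_{w,c}(a,b)\,d\gamma(a,b)$ is the Wasserstein distance with cost $d_{w,c}$, $\Gamma(p,p')$ the set of couplings with marginals $p,p'$. Expectations are over the randomness of the algorithm. *)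

theory Defs
  imports "HOL-Probability.Probability"
begin

definition clip :: "'a::real_normed_vector \<Rightarrow> real \<Rightarrow> 'a" where
  "clip g c = (if g = 0 then 0 else min 1 (c / norm g) *\<^sub>R g)"

definition hc :: "real \<Rightarrow> real \<Rightarrow> real" where
  "hc c y = min (y\<^sup>2) (3/4 * c * y)"

definition dwc :: "'a::real_inner \<Rightarrow> real \<Rightarrow> 'a \<Rightarrow> 'a \<Rightarrow> real" where
  "dwc w c a b = \<bar>inner w (clip (w + a) c) - inner w (clip (w + b) c)\<bar>"

definition couplings :: "'a::euclidean_space measure \<Rightarrow> 'a measure \<Rightarrow> ('a \<times> 'a) measure set" where
  "couplings p q = {\<gamma>. prob_space \<gamma> \<and> sets \<gamma> = sets (borel \<Otimes>\<^sub>M borel)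
      \<and> distr \<gamma> borel fst = p \<and> distr \<gamma> borel snd = q}"

definition Wdist :: "'a::euclidean_space \<Rightarrow> real \<Rightarrow> 'a measure \<Rightarrow> 'a measure \<Rightarrow> real" where
  "Wdist w c p q = Inf ((\<lambda>\<gamma>. \<integral>z. dwc w c (fst z) (snd z) \<partial>\<gamma>) ` couplings p q)"

definition gauss_vec :: "real \<Rightarrow> 'a::euclidean_space measure" where
  "gauss_vec \<sigma> = distr (PiM Basis (\<lambda>_. density lborel (normal_density 0 \<sigma>))) borel
      (\<lambda>z. \<Sum>b\<in>Basis. z b *\<^sub>R b)"

text \<open>Empirical distribution p_t: uniform over xi_i = grad f(x,s_i) - grad f(x), i < n.\<close>
definition emp_noise :: "(nat \<Rightarrow> 'a::euclidean_space \<Rightarrow> 'a) \<Rightarrow> ('a \<Rightarrow> 'a) \<Rightarrow> nat \<Rightarrow> 'a \<Rightarrow> 'a measure" where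
  "emp_noise gs F n x = distr (measure_pmf (pmf_of_set {..<n})) borel (\<lambda>i. gs i x - F x)"

text \<open>One DP-SGD step from x: S_t = m indices drawn uniformly with replacement from {0..<n},
  Z_t ~ N(0, sigma^2 I) independent; xi_{t,i} = gs i x - F x.\<close>
definition dpsgd_step :: "(nat \<Rightarrow> 'a::euclidean_space \<Rightarrow> 'a) \<Rightarrow> ('a \<Rightarrow> 'a) \<Rightarrow> nat \<Rightarrow> nat
    \<Rightarrow> real \<Rightarrow> real \<Rightarrow> real \<Rightarrow> 'a \<Rightarrow> 'a measure" where
  "dpsgd_step gs F n m c \<alpha> \<sigma> x =
     measure_pmf (Pi_pmf {..<m} 0 (\<lambda>_. pmf_of_set {..<n})) \<bind> (\<lambda>idx.
       gauss_vec \<sigma> \<bind> (\<lambda>z.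
         return borel (x - \<alpha> *\<^sub>R ((1 / real m) *\<^sub>R (\<Sum>j<m. clip (F x + (gs (idx j) x - F x)) c) + z))))"

text \<open>Distribution of the iterate x_{k+1} (so dpsgd_traj ... 0 is the point mass at x_1).\<close>
primrec dpsgd_traj :: "(nat \<Rightarrow> 'a::euclidean_space \<Rightarrow> 'a) \<Rightarrow> ('a \<Rightarrow> 'a) \<Rightarrow> nat \<Rightarrow> nat
    \<Rightarrow> real \<Rightarrow> real \<Rightarrow> real \<Rightarrow> 'a \<Rightarrow> nat \<Rightarrow> 'a measure" where
  "dpsgd_traj gs F n m c \<alpha> \<sigma> x1 0 = return borel x1"
| "dpsgd_traj gs F n m c \<alpha> \<sigma> x1 (Suc k) =
     dpsgd_traj gs F n m c \<alpha> \<sigma> x1 k \<bind> dpsgd_step gs F n m c \<alpha> \<sigma>"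

end

theory Submission
  imports Defs
begin

text \<open>Clipping is the projection onto the ball of radius \<open>c\<close>, hence odd and monotone. Pairing
  \<open>\<xi>\<close> with \<open>- \<xi>\<close> under a symmetric noise law therefore gives
  \<open>P(\<parallel>\<xi>\<parallel> < c/4) h_c(\<parallel>w\<parallel>) \<le> E \<langle>w, clip(w + \<xi>, c)\<rangle>\<close>, and replacing the symmetric law by
  the empirical one costs at most the Wasserstein distance. Inserted into the descent lemma for
  \<open>f\<close>, where the clipped gradient and the Gaussian noise contribute the second-order term
  \<open>G \<alpha>\<^sup>2 (c\<^sup>2 + d \<sigma>\<^sup>2) / 2\<close>, this telescopes along the trajectory. Privacy plays no role in the
  bound, so \<open>u = v = 1\<close> will do.\<close>

section \<open>Clipping: monotonicity and pairs of opposite noise vectors\<close>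

lemma clip_eq_scaleR:
  assumes "0 \<le> c"
  obtains s where "clip x c = s *\<^sub>R x" "s * norm x = min (norm x) c"
proof
  show "clip x c = min 1 (c / norm x) *\<^sub>R x"
    by (simp add: clip_def)
  show "min 1 (c / norm x) * norm x = min (norm x) c"
    using assms by (cases "x = 0") (auto simp: min_def field_simps)
qed

lemma clip_eq_self: "norm x \<le> c \<Longrightarrow> clip x c = x"
  by (auto simp: clip_def min_def field_simps)

lemma norm_clip_le:
  assumes "0 \<le> c"
  shows "norm (clip x c) \<le> c"
proof (cases "x = 0")
  case False
  then have "norm (clip x c) = min 1 (c / norm x) * norm x"
    using assms by (simp add: clip_def)
  also have "\<dots> \<le> c / norm x * norm x"
    by (intro mult_right_mono) auto
  finally show ?thesis
    using False by simp
qed (simp add: clip_def assms)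

lemma clip_uminus: "clip (- x) c = - clip x c"
  by (simp add: clip_def)

lemma clip_borel_measurable [measurable]:
  "(\<lambda>x::'a::euclidean_space. clip x c) \<in> borel_measurable borel"
  unfolding clip_def by measurable

lemma abs_inner_clip_le:
  assumes "0 \<le> c"
  shows "\<bar>inner w (clip x c)\<bar> \<le> c * norm w"
proof -
  have "\<bar>inner w (clip x c)\<bar> \<le> norm w * norm (clip x c)"
    by (rule Cauchy_Schwarz_ineq2)
  also have "\<dots> \<le> norm w * c"
    by (intro mult_left_mono norm_clip_le assms) simp
  finally show ?thesis by (simp add: mult.commute)
qed

text \<open>Expand the product. The diagonal terms are exactly
  \<open>min (norm x) c * norm x\<close> and its analogue for \<open>y\<close>, and Cauchy-Schwarz
  bounds the cross terms. What remains is
  \<open>(min (norm x) c - min (norm y) c) * (norm x - norm y)\<close>, nonnegative because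
  \<open>min _ c\<close> is nondecreasing.\<close>

lemma clip_monotone:
  fixes x y :: "'a::real_inner"
  assumes "0 \<le> c"
  shows "0 \<le> inner (clip x c - clip y c) (x - y)"
proof -
  obtain s where s: "clip x c = s *\<^sub>R x" "s * norm x = min (norm x) c"
    using clip_eq_scaleR[OF assms] .
  obtain t where t: "clip y c = t *\<^sub>R y" "t * norm y = min (norm y) c"
    using clip_eq_scaleR[OF assms] .
  have cs: "inner (clip a c) b \<le> min (norm a) c * norm b" for a b :: 'a
  proof -
    have "norm (clip a c) \<le> min (norm a) c"
      by (metis assms clip_eq_self linorder_le_cases min_def norm_clip_le order_refl)
    then show ?thesis
      by (meson mult_right_mono norm_cauchy_schwarz norm_ge_zero order_trans)
  qed
  have "0 \<le> (min (norm x) c - min (norm y) c) * (norm x - norm y)"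
    by (auto simp: min_def mult_nonneg_nonneg mult_nonpos_nonpos zero_le_mult_iff)
  also have "\<dots> = min (norm x) c * norm x + min (norm y) c * norm y
      - min (norm x) c * norm y - min (norm y) c * norm x"
    by (simp add: algebra_simps)
  also have "min (norm x) c * norm x = inner (clip x c) x"
    using s by (simp add: power2_norm_eq_inner[symmetric] power2_eq_square mult.assoc[symmetric])
  also have "min (norm y) c * norm y = inner (clip y c) y"
    using t by (simp add: power2_norm_eq_inner[symmetric] power2_eq_square mult.assoc[symmetric])
  finally show ?thesis
    using cs[of x y] cs[of y x] by (simp add: inner_diff_left inner_diff_right)
qed

text \<open>By oddness the second clip is minus the clip of \<open>\<xi> - w\<close>, and the
  arguments \<open>w + \<xi>\<close> and \<open>\<xi> - w\<close> differ by
  \<open>2 *\<^sub>R w\<close>, so this is monotonicity of clipping.\<close>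

lemma inner_clip_pair_nonneg:
  assumes "0 \<le> c"
  shows "0 \<le> inner w (clip (w + \<xi>) c) + inner w (clip (w - \<xi>) c)"
proof -
  have "clip (w - \<xi>) c = - clip (\<xi> - w) c"
    using clip_uminus[of "\<xi> - w" c] by simp
  moreover have "0 \<le> inner (clip (w + \<xi>) c - clip (\<xi> - w) c) ((w + \<xi>) - (\<xi> - w))"
    by (rule clip_monotone[OF assms])
  moreover have "(w + \<xi>) - (\<xi> - w) = 2 *\<^sub>R w"
    by (simp add: scaleR_2)
  ultimately show ?thesis
    by (simp add: inner_commute[of _ w] inner_diff_right)
qed

text \<open>The constants fit because 3/4 + 1/4 = 1: for \<open>norm w\<close> at most
  \<open>3/4 * c\<close> neither vector of the pair is clipped, the noise cancels and twice the
  squared norm is left. Larger \<open>w\<close> give the linear branch of \<open>hc\<close>.\<close>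

lemma inner_clip_pair_ge:
  assumes c: "0 < c" and \<xi>: "norm \<xi> < c / 4"
  shows "2 * hc c (norm w) \<le> inner w (clip (w + \<xi>) c) + inner w (clip (w - \<xi>) c)"
proof (cases "norm w \<le> 3/4 * c")
  case True
  have "norm (w + \<xi>) \<le> c" "norm (w - \<xi>) \<le> c"
    using True \<xi> norm_triangle_ineq[of w \<xi>] norm_triangle_ineq4[of w \<xi>] by linarith+
  then have "inner w (clip (w + \<xi>) c) + inner w (clip (w - \<xi>) c) = 2 * (norm w)\<^sup>2"
    by (simp add: clip_eq_self inner_add_right inner_diff_right power2_norm_eq_inner)
  then show ?thesis
    by (simp add: hc_def)
next
  case False
  \<comment> \<open>Shrink \<open>w\<close> to norm \<open>3c/4\<close>, where nothing is clipped; monotonicity of clipping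
    transports the bound back along the ray.\<close>
  define r where "r = 3/4 * c / norm w"
  define w' where "w' = r *\<^sub>R w"
  have w: "0 < norm w"
    using False c by linarith
  then have r: "0 < r" "r < 1"
    using False c by (auto simp: r_def field_simps)
  have nw': "norm w' = 3/4 * c"
    using w r by (simp add: w'_def) (simp add: r_def)
  have ray: "inner w (clip (w' + \<eta>) c) \<le> inner w (clip (w + \<eta>) c)" for \<eta>
  proof -
    have "0 \<le> inner (clip (w + \<eta>) c - clip (w' + \<eta>) c) ((w + \<eta>) - (w' + \<eta>))"
      using c by (intro clip_monotone) simp
    also have "(w + \<eta>) - (w' + \<eta>) = (1 - r) *\<^sub>R w"
      by (simp add: w'_def algebra_simps)
    finally have "0 \<le> inner (clip (w + \<eta>) c - clip (w' + \<eta>) c) w"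
      using r by (simp add: zero_le_mult_iff)
    then show ?thesis
      by (simp add: inner_diff_left inner_diff_right inner_commute)
  qed
  have "norm (w' + \<xi>) \<le> c" "norm (w' - \<xi>) \<le> c"
    using nw' \<xi> norm_triangle_ineq[of w' \<xi>] norm_triangle_ineq4[of w' \<xi>] by linarith+
  then have "inner w (clip (w' + \<xi>) c) + inner w (clip (w' - \<xi>) c) = 2 * inner w w'"
    by (simp add: clip_eq_self inner_add_right inner_diff_right)
  also have "inner w w' = 3/4 * c * norm w"
    using w by (simp add: w'_def r_def power2_norm_eq_inner[symmetric] power2_eq_square)
  finally have "2 * (3/4 * c * norm w) \<le> inner w (clip (w + \<xi>) c) + inner w (clip (w - \<xi>) c)"
    using ray[of \<xi>] ray[of "- \<xi>"] by simp
  then show ?thesis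
    by (simp add: hc_def)
qed

section \<open>Expectations under a symmetric noise law\<close>

lemma hc_nonneg: "0 \<le> c \<Longrightarrow> 0 \<le> y \<Longrightarrow> 0 \<le> hc c y"
  by (simp add: hc_def)

lemma (in prob_space) integrable_inner_clip:
  fixes X :: "'a \<Rightarrow> 'b::euclidean_space"
  assumes "0 \<le> c" and [measurable]: "X \<in> borel_measurable M"
  shows "integrable M (\<lambda>z. inner w (clip (w + X z) c))"
  by (rule integrable_const_bound[where B = "c * norm w"])
    (auto intro!: abs_inner_clip_le assms(1))

text \<open>Symmetry lets the integrand be averaged with its mirror image. Each pair contributes at
  least \<open>2 * hc c (norm w)\<close> inside the small ball and at least 0 outside it, whence the
  factor given by the mass of the ball.\<close>

lemma symmetric_clip_bound:
  fixes p :: "'a::euclidean_space measure"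
  assumes c: "0 < c" and p: "prob_space p" and sets_p [measurable_cong]: "sets p = sets borel"
    and sym: "distr p borel uminus = p"
  shows "measure p {\<xi>. norm \<xi> < c / 4} * hc c (norm w) \<le> (\<integral>\<xi>. inner w (clip (w + \<xi>) c) \<partial>p)"
proof -
  interpret prob_space p by fact
  let ?X = "\<lambda>\<xi>. inner w (clip (w + \<xi>) c)" and ?B = "{\<xi>::'a. norm \<xi> < c / 4}"
  have B [measurable]: "?B \<in> sets p"
    by (simp add: sets_p)
  have X: "integrable p ?X" and X': "integrable p (\<lambda>\<xi>. ?X (- \<xi>))"
    by (rule integrable_inner_clip; use c in simp)+
  have "(\<integral>\<xi>. ?X \<xi> \<partial>p) = (\<integral>\<xi>. ?X \<xi> \<partial>distr p borel uminus)"
    by (simp add: sym)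
  also have "\<dots> = (\<integral>\<xi>. ?X (- \<xi>) \<partial>p)"
    by (rule integral_distr) measurable
  finally have eq: "(\<integral>\<xi>. ?X (- \<xi>) \<partial>p) = (\<integral>\<xi>. ?X \<xi> \<partial>p)" ..
  have "measure p ?B * (2 * hc c (norm w)) = (\<integral>\<xi>. indicator ?B \<xi> * (2 * hc c (norm w)) \<partial>p)"
    by (simp add: sets_eq_imp_space_eq[OF sets_p])
  also have "\<dots> \<le> (\<integral>\<xi>. ?X \<xi> + ?X (- \<xi>) \<partial>p)"
  proof (rule integral_mono)
    show "integrable p (\<lambda>\<xi>. indicator ?B \<xi> * (2 * hc c (norm w)))"
      by (intro integrable_mult_left integrable_real_indicator B) (simp add: emeasure_eq_measure)
    show "integrable p (\<lambda>\<xi>. ?X \<xi> + ?X (- \<xi>))"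
      using X X' by simp
    show "indicator ?B \<xi> * (2 * hc c (norm w)) \<le> ?X \<xi> + ?X (- \<xi>)" for \<xi>
      using inner_clip_pair_ge[OF c, of \<xi> w] inner_clip_pair_nonneg[of c w \<xi>] c
      by (auto simp: indicator_def)
  qed
  also have "\<dots> = 2 * (\<integral>\<xi>. ?X \<xi> \<partial>p)"
    using X X' eq by simp
  finally show ?thesis by simp
qed

section \<open>Couplings and the Wasserstein distance with clipped cost\<close>

lemma dwc_nonneg: "0 \<le> dwc w c a b"
  by (simp add: dwc_def)

lemma dwc_le: "0 \<le> c \<Longrightarrow> dwc w c a b \<le> 2 * c * norm w"
  using abs_inner_clip_le[of c w "w + a"] abs_inner_clip_le[of c w "w + b"]
  unfolding dwc_def by linarith

lemma integrable_dwc: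
  fixes w :: "'a::euclidean_space"
  assumes "0 \<le> c" "\<gamma> \<in> couplings p q"
  shows "integrable \<gamma> (\<lambda>z. dwc w c (fst z) (snd z))"
proof -
  interpret prob_space \<gamma>
    using assms by (simp add: couplings_def)
  have [measurable_cong]: "sets \<gamma> = sets (borel \<Otimes>\<^sub>M borel)"
    using assms by (simp add: couplings_def)
  have [measurable]: "(\<lambda>z. dwc w c (fst z) (snd z)) \<in> borel_measurable \<gamma>"
    unfolding dwc_def by measurable
  show ?thesis
    by (rule integrable_const_bound[where B = "2 * c * norm w"])
      (auto simp: dwc_nonneg intro!: dwc_le assms)
qed

text \<open>The independent coupling makes the set under the infimum in \<open>Wdist\<close>
  nonempty, without which a real infimum carries no information.\<close>

lemma pair_measure_in_couplings:
  fixes p q :: "'a::euclidean_space measure"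
  assumes "prob_space p" "prob_space q" and p: "sets p = sets borel" and q: "sets q = sets borel"
  shows "p \<Otimes>\<^sub>M q \<in> couplings p q"
proof -
  interpret p: prob_space p by fact
  interpret q: prob_space q by fact
  interpret pair_prob_space p q ..
  have "distr (p \<Otimes>\<^sub>M q) borel fst = distr (p \<Otimes>\<^sub>M q) p fst"
    by (rule distr_cong) (simp_all add: p)
  moreover have "distr (p \<Otimes>\<^sub>M q) borel snd = distr (p \<Otimes>\<^sub>M q) q snd"
    by (rule distr_cong) (simp_all add: q)
  moreover have "prob_space (p \<Otimes>\<^sub>M q)"
    by (rule P.prob_space_axioms)
  moreover have "distr (p \<Otimes>\<^sub>M q) q snd = q"
  proof (rule measure_eqI)
    fix A assume "A \<in> sets (distr (p \<Otimes>\<^sub>M q) q snd)"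
    then have A: "A \<in> sets q" by simp
    then have "snd -` A \<inter> space (p \<Otimes>\<^sub>M q) = space p \<times> A"
      by (auto simp: space_pair_measure dest: sets.sets_into_space)
    then show "emeasure (distr (p \<Otimes>\<^sub>M q) q snd) A = emeasure q A"
      using A by (simp add: emeasure_distr q.emeasure_pair_measure_Times p.emeasure_space_1)
  qed simp
  ultimately show ?thesis
    using sets_pair_measure_cong[OF p q]
    by (simp add: couplings_def q.distr_pair_fst)
qed

lemma Wdist_nonneg:
  fixes w :: "'a::euclidean_space"
  assumes "couplings p q \<noteq> {}"
  shows "0 \<le> Wdist w c p q"
  unfolding Wdist_def
  by (rule cInf_greatest) (use assms in \<open>auto intro!: integral_nonneg_AE simp: dwc_nonneg\<close>)

text \<open>Serves as the majorant that makes the Wasserstein term integrable along the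
  trajectory.\<close>

lemma Wdist_le:
  fixes w :: "'a::euclidean_space"
  assumes "0 \<le> c" "couplings p q \<noteq> {}"
  shows "Wdist w c p q \<le> 2 * c * norm w"
proof -
  obtain \<gamma> where \<gamma>: "\<gamma> \<in> couplings p q"
    using assms by auto
  interpret prob_space \<gamma>
    using \<gamma> by (simp add: couplings_def)
  have "Wdist w c p q \<le> (\<integral>z. dwc w c (fst z) (snd z) \<partial>\<gamma>)"
    unfolding Wdist_def using \<gamma>
    by (intro cInf_lower bdd_belowI[of _ 0]) (auto intro!: integral_nonneg_AE simp: dwc_nonneg)
  also have "\<dots> \<le> 2 * c * norm w"
    by (rule integral_le_const[OF integrable_dwc[OF assms(1) \<gamma>]]) (simp add: dwc_le assms)
  finally show ?thesis .
qed

text \<open>The easy direction of Kantorovich duality: under any coupling the difference of the two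
  integrals is one integral of a difference, which the cost \<open>dwc\<close> dominates pointwise.
  Then pass to the infimum.\<close>

lemma integral_diff_le_Wdist:
  fixes w :: "'a::euclidean_space"
  assumes c: "0 \<le> c" and ne: "couplings p q \<noteq> {}"
  shows "(\<integral>\<xi>. inner w (clip (w + \<xi>) c) \<partial>p) - (\<integral>\<xi>. inner w (clip (w + \<xi>) c) \<partial>q) \<le> Wdist w c p q"
  unfolding Wdist_def
proof (rule cInf_greatest; (elim imageE)?)
  fix y \<gamma> assume y: "y = (\<integral>z. dwc w c (fst z) (snd z) \<partial>\<gamma>)" and \<gamma>: "\<gamma> \<in> couplings p q"
  let ?X = "\<lambda>\<xi>. inner w (clip (w + \<xi>) c)"
  interpret prob_space \<gamma>
    using \<gamma> by (simp add: couplings_def)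
  have [measurable_cong]: "sets \<gamma> = sets (borel \<Otimes>\<^sub>M borel)"
    and p: "distr \<gamma> borel fst = p" and q: "distr \<gamma> borel snd = q"
    using \<gamma> by (simp_all add: couplings_def)
  have int: "integrable \<gamma> (\<lambda>z. ?X (fst z))" "integrable \<gamma> (\<lambda>z. ?X (snd z))"
    by (auto intro!: integrable_inner_clip c)
  have "integral\<^sup>L p ?X - integral\<^sup>L q ?X = (\<integral>z. ?X (fst z) \<partial>\<gamma>) - (\<integral>z. ?X (snd z) \<partial>\<gamma>)"
    unfolding p[symmetric] q[symmetric] by (subst (1 2) integral_distr) measurable
  also have "\<dots> = (\<integral>z. ?X (fst z) - ?X (snd z) \<partial>\<gamma>)"
    using int by simp
  also have "\<dots> \<le> y"
    unfolding y by (intro integral_mono integrable_dwc[OF c \<gamma>] Bochner_Integration.integrable_diff int)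
      (simp add: dwc_def)
  finally show "integral\<^sup>L p ?X - integral\<^sup>L q ?X \<le> y" .
qed (use ne in simp)

section \<open>Functions with Lipschitz gradient\<close>

lemma GDERIV_has_field_derivative_line:
  assumes "GDERIV f (x + t *\<^sub>R h) :> D"
  shows "((\<lambda>t. f (x + t *\<^sub>R h)) has_field_derivative inner D h) (at t)"
proof (rule has_derivative_imp_has_field_derivative)
  show "((\<lambda>t. f (x + t *\<^sub>R h)) has_derivative (\<lambda>s. inner (s *\<^sub>R h) D)) (at t)"
    by (rule has_derivative_compose[where g = f])
      (use assms in \<open>auto simp: gderiv_def intro!: derivative_eq_intros\<close>)
qed (simp add: inner_commute)

text \<open>Along the segment from \<open>x\<close> to \<open>x + h\<close>, subtract from
  \<open>f\<close> its linear part and the quadratic with curvature \<open>G\<close>. By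
  Cauchy-Schwarz and the Lipschitz bound the result has nonpositive derivative, so comparing the
  endpoints suffices.\<close>

lemma descent_lemma:
  fixes f :: "'a::real_inner \<Rightarrow> real"
  assumes F: "\<And>x. GDERIV f x :> F x" and lip: "\<And>x y. norm (F x - F y) \<le> G * norm (x - y)"
  shows "f (x + h) \<le> f x + inner (F x) h + G / 2 * (norm h)\<^sup>2"
proof -
  let ?\<phi> = "\<lambda>t. f (x + t *\<^sub>R h) - t * inner (F x) h - G / 2 * t\<^sup>2 * (norm h)\<^sup>2"
  have "?\<phi> 1 \<le> ?\<phi> 0"
  proof (rule DERIV_nonpos_imp_nonincreasing[where f = ?\<phi>])
    fix t :: real assume t: "0 \<le> t" "t \<le> 1"
    have "(?\<phi> has_field_derivative
        inner (F (x + t *\<^sub>R h)) h - inner (F x) h - G * t * (norm h)\<^sup>2) (at t)"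
      by (auto intro!: derivative_eq_intros GDERIV_has_field_derivative_line F)
    moreover have "inner (F (x + t *\<^sub>R h)) h - inner (F x) h \<le> G * t * (norm h)\<^sup>2"
    proof -
      have "inner (F (x + t *\<^sub>R h)) h - inner (F x) h = inner (F (x + t *\<^sub>R h) - F x) h"
        by (simp add: inner_diff_left)
      also have "\<dots> \<le> norm (F (x + t *\<^sub>R h) - F x) * norm h"
        by (rule norm_cauchy_schwarz)
      also have "\<dots> \<le> (G * norm ((x + t *\<^sub>R h) - x)) * norm h"
        by (intro mult_right_mono lip) simp
      finally show ?thesis
        using t by (simp add: power2_eq_square mult.assoc)
    qed
    ultimately show "\<exists>y. DERIV ?\<phi> t :> y \<and> y \<le> 0"
      by (intro exI conjI) auto
  qed simp
  then show ?thesis by simp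
qed

text \<open>A gradient step of length \<open>1 / G\<close> minimises the quadratic upper model and
  gains \<open>(norm (F x))\<^sup>2 / (2 * G)\<close>, yet it cannot go below the lower bound
  \<open>f0\<close>.\<close>

lemma norm_gradient_sq_le:
  fixes f :: "'a::real_inner \<Rightarrow> real"
  assumes F: "\<And>x. GDERIV f x :> F x" and lip: "\<And>x y. norm (F x - F y) \<le> G * norm (x - y)"
    and "0 < G" and min: "\<And>x. f0 \<le> f x"
  shows "(norm (F x))\<^sup>2 \<le> 2 * G * (f x - f0)"
proof -
  have "f0 \<le> f (x + (- (1 / G)) *\<^sub>R F x)"
    by (rule min)
  also have "\<dots> \<le> f x + inner (F x) ((- (1 / G)) *\<^sub>R F x) + G / 2 * (norm ((- (1 / G)) *\<^sub>R F x))\<^sup>2"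
    by (rule descent_lemma[OF F lip])
  also have "\<dots> = f x - (norm (F x))\<^sup>2 / (2 * G)"
    using \<open>0 < G\<close> by (simp add: power2_norm_eq_inner[symmetric] power_mult_distrib power2_eq_square field_simps)
  finally show ?thesis
    using \<open>0 < G\<close> by (simp add: field_simps)
qed

text \<open>A gradient is a pointwise limit of measurable difference quotients in each coordinate.
  This covers the per-sample gradients, about which no continuity is assumed.\<close>

lemma GDERIV_borel_measurable:
  fixes f :: "'a::euclidean_space \<Rightarrow> real"
  assumes F: "\<And>x. GDERIV f x :> F x"
  shows "f \<in> borel_measurable borel" "F \<in> borel_measurable borel"
proof -
  have "continuous_on UNIV f"
    using F by (auto intro!: continuous_at_imp_continuous_on has_derivative_continuous simp: gderiv_def)
  then show f [measurable]: "f \<in> borel_measurable borel"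
    by (rule borel_measurable_continuous_onI)
  have "(\<lambda>x. inner (F x) b) \<in> borel_measurable borel" for b
  proof (rule borel_measurable_LIMSEQ_metric)
    show "(\<lambda>x. (f (x + (1 / real (Suc k)) *\<^sub>R b) - f x) / (1 / real (Suc k))) \<in> borel_measurable borel" for k
      by measurable
    fix x
    have "((\<lambda>t. f (x + t *\<^sub>R b)) has_field_derivative inner (F x) b) (at 0)"
      by (rule GDERIV_has_field_derivative_line) (simp add: F)
    then have "((\<lambda>t. (f (x + t *\<^sub>R b) - f x) / t) \<longlongrightarrow> inner (F x) b) (at 0)"
      by (simp add: DERIV_def)
    \<comment> \<open>The index \<open>Suc k\<close> keeps the increments different from 0, as the
      punctured filter \<open>at 0\<close> demands.\<close>
    moreover have "filterlim (\<lambda>k. 1 / real (Suc k)) (at 0) sequentially"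
      unfolding filterlim_at by (auto intro!: lim_1_over_n LIMSEQ_Suc simp del: of_nat_Suc)
    ultimately show "(\<lambda>k. (f (x + (1 / real (Suc k)) *\<^sub>R b) - f x) / (1 / real (Suc k)))
        \<longlonglongrightarrow> inner (F x) b"
      by (rule filterlim_compose)
  qed
  then show "F \<in> borel_measurable borel"
    by (subst borel_measurable_euclidean_space) simp
qed

section \<open>Moments of the isotropic Gaussian\<close>

lemma gauss_vec:
  fixes \<sigma> :: real
  assumes \<sigma>: "0 < \<sigma>"
  shows prob_space_gauss_vec: "prob_space (gauss_vec \<sigma> :: 'a::euclidean_space measure)"
    and sets_gauss_vec: "sets (gauss_vec \<sigma> :: 'a measure) = sets borel"
    and integrable_gauss_vec_inner: "integrable (gauss_vec \<sigma>) (\<lambda>z::'a. inner w z)"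
    and integral_gauss_vec_inner: "(\<integral>z. inner (w::'a) z \<partial>gauss_vec \<sigma>) = 0"
    and integrable_gauss_vec_norm_sq: "integrable (gauss_vec \<sigma>) (\<lambda>z::'a. (norm z)\<^sup>2)"
    and integral_gauss_vec_norm_sq: "(\<integral>z. (norm (z::'a))\<^sup>2 \<partial>gauss_vec \<sigma>) = real DIM('a) * \<sigma>\<^sup>2"
proof -
  let ?N = "density lborel (normal_density 0 \<sigma>)"
  let ?P = "PiM Basis (\<lambda>_::'a. ?N)" and ?v = "\<lambda>z. \<Sum>b\<in>Basis. z b *\<^sub>R (b::'a)"
  interpret N: prob_space ?N
    by (rule prob_space_normal_density[OF \<sigma>])
  interpret P: product_prob_space "\<lambda>_::'a. ?N" Basis ..
  have v [measurable]: "?v \<in> borel_measurable ?P"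
    by measurable
  show "prob_space (gauss_vec \<sigma> :: 'a measure)"
    unfolding gauss_vec_def by (intro P.prob_space_distr v)
  show "sets (gauss_vec \<sigma> :: 'a measure) = sets borel"
    by (simp add: gauss_vec_def)
  have inner_v: "inner w (?v z) = (\<Sum>b\<in>Basis. inner w b * z b)" for w z
    by (simp add: inner_sum_right mult.commute)
  have norm_v: "(norm (?v z))\<^sup>2 = (\<Sum>b\<in>Basis. (z b)\<^sup>2)" for z
    unfolding power2_norm_eq_inner by (subst euclidean_inner) (simp add: power2_eq_square)
  have N1: "has_bochner_integral ?N (\<lambda>x. x) 0"
    using normal_moment_nz_1[OF \<sigma>, of 0] by (intro has_bochner_integral_density) auto
  \<comment> \<open>The even-moment formula for exponent 2 reads 2! / (2 / \<sigma>^2), which is the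
    variance.\<close>
  have N2: "has_bochner_integral ?N (\<lambda>x. x\<^sup>2) (\<sigma>\<^sup>2)"
    using normal_moment_even[OF \<sigma>, of 0 1] \<sigma>
    by (intro has_bochner_integral_density) (auto simp: fact_numeral power2_eq_square)
  \<comment> \<open>Each coordinate of the product measure has law \<open>?N\<close>, so
    one-dimensional moments transfer and the vector moments become sums over
    \<open>Basis\<close>.\<close>
  have comp: "has_bochner_integral ?P (\<lambda>z. g (z b)) r"
    if "b \<in> Basis" "has_bochner_integral ?N g r" for g :: "real \<Rightarrow> real" and r and b :: 'a
  proof -
    have "distr ?P ?N (\<lambda>z. z b) = ?N"
      by (rule P.PiM_component) fact
    then have "has_bochner_integral (distr ?P ?N (\<lambda>z. z b)) g r"
      using that by simp
    moreover have "(\<lambda>z. z b) \<in> measurable ?P ?N"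
      using that by (intro measurable_component_singleton)
    moreover have "g \<in> borel_measurable ?N"
      using that by (auto simp: has_bochner_integral_iff)
    ultimately show ?thesis
      unfolding has_bochner_integral_iff by (metis integrable_distr_eq integral_distr)
  qed
  have "has_bochner_integral ?P (\<lambda>z. inner w (?v z)) (\<Sum>b\<in>Basis. inner w b * 0)"
    unfolding inner_v
    by (intro has_bochner_integral_sum has_bochner_integral_mult_right comp N1) auto
  then have "has_bochner_integral ?P (\<lambda>z. inner w (?v z)) 0"
    by simp
  then show "integrable (gauss_vec \<sigma>) (\<lambda>z::'a. inner w z)" "(\<integral>z. inner (w::'a) z \<partial>gauss_vec \<sigma>) = 0"
    unfolding gauss_vec_def
    by (simp_all add: integrable_distr_eq integral_distr has_bochner_integral_iff)
  have "has_bochner_integral ?P (\<lambda>z. (norm (?v z))\<^sup>2) (\<Sum>b\<in>(Basis::'a set). \<sigma>\<^sup>2)"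
    unfolding norm_v by (intro has_bochner_integral_sum comp N2)
  then show "integrable (gauss_vec \<sigma>) (\<lambda>z::'a. (norm z)\<^sup>2)"
    "(\<integral>z. (norm (z::'a))\<^sup>2 \<partial>gauss_vec \<sigma>) = real DIM('a) * \<sigma>\<^sup>2"
    unfolding gauss_vec_def
    by (simp_all add: integrable_distr_eq integral_distr has_bochner_integral_iff)
qed


section \<open>The DP-SGD chain: sampled gradients\<close>

locale dpsgd =
  fixes n m :: nat and gs :: "nat \<Rightarrow> 'a::euclidean_space \<Rightarrow> 'a" and f :: "'a \<Rightarrow> real"
    and F :: "'a \<Rightarrow> 'a" and G c \<alpha> \<sigma> f0 :: real
  assumes n: "1 \<le> n" and m: "1 \<le> m"
    and gs_measurable: "\<And>i. i < n \<Longrightarrow> gs i \<in> borel_measurable borel"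
    and grad: "\<And>x. GDERIV f x :> F x"
    and lip: "\<And>x y. norm (F x - F y) \<le> G * norm (x - y)"
    and f_ge: "\<And>x. f0 \<le> f x"
    and G: "0 < G" and c: "0 < c" and \<alpha>: "0 \<le> \<alpha>" and \<sigma>: "0 < \<sigma>"
begin

abbreviation batch :: "(nat \<Rightarrow> nat) pmf" where
  "batch \<equiv> Pi_pmf {..<m} 0 (\<lambda>_. pmf_of_set {..<n})"

text \<open>In the algorithm the clipped argument is \<open>F x + (gs i x - F x)\<close>; the
  recentring cancels, leaving the raw sample gradient.\<close>

definition batch_grad :: "(nat \<Rightarrow> nat) \<Rightarrow> 'a \<Rightarrow> 'a" where
  "batch_grad idx x = (1 / real m) *\<^sub>R (\<Sum>j<m. clip (gs (idx j) x) c)"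

text \<open>The quantity where both halves of the argument meet: it is the mean of
  \<open>batch_grad\<close> over the random batch and also the mean of the clipped noisy gradient
  under \<open>emp_noise\<close>.\<close>

definition mean_grad :: "'a \<Rightarrow> 'a" where
  "mean_grad x = (1 / real n) *\<^sub>R (\<Sum>i<n. clip (gs i x) c)"

text \<open>Bounds the expected second-order term of the descent lemma: the clipped part has norm at
  most \<open>c\<close>, the Gaussian has second moment \<open>DIM('a) * \<sigma>\<^sup>2\<close>,
  and the cross term has mean zero.\<close>

definition noise_cost :: real where
  "noise_cost = G * \<alpha>\<^sup>2 / 2 * (c\<^sup>2 + real DIM('a) * \<sigma>\<^sup>2)"

abbreviation step :: "'a \<Rightarrow> 'a measure" where
  "step \<equiv> dpsgd_step gs F n m c \<alpha> \<sigma>"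

abbreviation traj :: "'a \<Rightarrow> nat \<Rightarrow> 'a measure" where
  "traj \<equiv> dpsgd_traj gs F n m c \<alpha> \<sigma>"

lemma f_measurable [measurable]: "f \<in> borel_measurable borel"
  and F_measurable [measurable]: "F \<in> borel_measurable borel"
  using GDERIV_borel_measurable[OF grad] by auto

lemma noise_cost_nonneg: "0 \<le> noise_cost"
  using G by (simp add: noise_cost_def)

lemma finite_set_batch: "finite (set_pmf batch)"
  using n by (subst set_Pi_pmf) (auto intro!: finite_PiE_dflt simp: lessThan_empty_iff)

lemma batch_less: "idx \<in> set_pmf batch \<Longrightarrow> j < m \<Longrightarrow> idx j < n"
  using n by (subst (asm) set_Pi_pmf) (auto simp: PiE_dflt_def lessThan_empty_iff)

lemma norm_batch_grad_le: "norm (batch_grad idx x) \<le> c"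
proof -
  have "norm (\<Sum>j<m. clip (gs (idx j) x) c) \<le> (\<Sum>j<m. c)"
    using c by (intro sum_norm_le norm_clip_le) simp
  then show ?thesis
    using m by (simp add: batch_grad_def field_simps)
qed

lemma norm_mean_grad_le: "norm (mean_grad x) \<le> c"
proof -
  have "norm (\<Sum>i<n. clip (gs i x) c) \<le> (\<Sum>i<n. c)"
    using c by (intro sum_norm_le norm_clip_le) simp
  then show ?thesis
    using n by (simp add: mean_grad_def field_simps)
qed

text \<open>By linearity it is enough to treat one draw, and each coordinate of the batch is uniform
  on \<open>{..<n}\<close>.\<close>

lemma integral_inner_batch_grad:
  "(\<integral>idx. inner w (batch_grad idx x) \<partial>measure_pmf batch) = inner w (mean_grad x)"
proof -
  have "(\<integral>idx. inner w (clip (gs (idx j) x) c) \<partial>measure_pmf batch)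
      = inner w (mean_grad x)" if "j < m" for j
  proof -
    have "(\<integral>idx. inner w (clip (gs (idx j) x) c) \<partial>measure_pmf batch)
        = (\<integral>i. inner w (clip (gs i x) c) \<partial>measure_pmf (map_pmf (\<lambda>idx. idx j) batch))"
      by simp
    also have "map_pmf (\<lambda>idx. idx j) batch = pmf_of_set {..<n}"
      using that by (subst Pi_pmf_component) auto
    also have "(\<integral>i. inner w (clip (gs i x) c) \<partial>measure_pmf (pmf_of_set {..<n}))
        = inner w (mean_grad x)"
      using n by (subst integral_pmf_of_set)
        (auto simp: mean_grad_def inner_sum_right lessThan_empty_iff)
    finally show ?thesis .
  qed
  then have "(\<Sum>j<m. \<integral>idx. inner w (clip (gs (idx j) x) c) \<partial>measure_pmf batch)
      = real m * inner w (mean_grad x)"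
    by simp
  then show ?thesis
    using m by (simp add: batch_grad_def inner_sum_right integrable_measure_pmf_finite finite_set_batch)
qed

section \<open>The one-step transition kernel\<close>

lemma step_eq:
  "step x = measure_pmf batch \<bind> (\<lambda>idx. distr (gauss_vec \<sigma>) borel (\<lambda>z. x - \<alpha> *\<^sub>R (batch_grad idx x + z)))"
proof -
  have [measurable_cong]: "sets (gauss_vec \<sigma> :: 'a measure) = sets borel"
    by (rule sets_gauss_vec[OF \<sigma>])
  interpret prob_space "gauss_vec \<sigma> :: 'a measure"
    by (rule prob_space_gauss_vec[OF \<sigma>])
  show ?thesis
    unfolding dpsgd_step_def by (subst bind_return_distr') (auto simp: batch_grad_def not_empty)
qed

lemma prob_space_gauss_shift:
  "prob_space (distr (gauss_vec \<sigma>) borel (\<lambda>z. x - \<alpha> *\<^sub>R (y + z)) :: 'a measure)"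
proof -
  have [measurable_cong]: "sets (gauss_vec \<sigma> :: 'a measure) = sets borel"
    by (rule sets_gauss_vec[OF \<sigma>])
  show ?thesis
    by (intro prob_space.prob_space_distr prob_space_gauss_vec \<sigma>) measurable
qed

text \<open>Every map out of the discrete sigma-algebra of a pmf is measurable; only the target
  space has to be checked.\<close>

lemma batch_kernel_measurable:
  "(\<lambda>idx. distr (gauss_vec \<sigma>) borel (\<lambda>z. x - \<alpha> *\<^sub>R (batch_grad idx x + z)))
    \<in> measurable (measure_pmf batch) (subprob_algebra borel)"
  by (auto simp: space_subprob_algebra prob_space_imp_subprob_space prob_space_gauss_shift)

lemma prob_space_step: "prob_space (step x)" and sets_step: "sets (step x) = sets borel"
  unfolding step_eq
  by (rule measure_pmf.prob_space_bind[OF _ batch_kernel_measurable])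
    (auto simp: prob_space_gauss_shift intro!: sets_bind)

text \<open>Since the batch has finite support, the mass of a measurable set is a finite weighted
  sum of Gaussian integrals, each measurable in the starting point.\<close>

lemma step_measurable [measurable]: "step \<in> measurable borel (subprob_algebra borel)"
proof (rule measurable_subprob_algebra)
  fix A :: "'a set" assume A [measurable]: "A \<in> sets borel"
  have [measurable_cong]: "sets (gauss_vec \<sigma> :: 'a measure) = sets borel"
    by (rule sets_gauss_vec[OF \<sigma>])
  interpret prob_space "gauss_vec \<sigma> :: 'a measure"
    by (rule prob_space_gauss_vec[OF \<sigma>])
  have "emeasure (step x) A = (\<Sum>idx\<in>set_pmf batch.
      (\<integral>\<^sup>+z. indicator A (x - \<alpha> *\<^sub>R (batch_grad idx x + z)) \<partial>gauss_vec \<sigma>) * pmf batch idx)" for x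
    unfolding step_eq emeasure_bind[OF _ batch_kernel_measurable A, simplified]
    by (subst nn_integral_measure_pmf_finite[OF finite_set_batch])
      (simp_all add: nn_integral_distr flip: nn_integral_indicator)
  \<comment> \<open>The restriction to the support matters: \<open>gs i\<close> is known to be
    measurable only for \<open>i < n\<close>.\<close>
  moreover have "(\<lambda>x. \<integral>\<^sup>+z. indicator A (x - \<alpha> *\<^sub>R (batch_grad idx x + z)) \<partial>gauss_vec \<sigma>)
      \<in> borel_measurable borel" if "idx \<in> set_pmf batch" for idx
  proof -
    have [measurable]: "batch_grad idx \<in> borel_measurable borel"
      unfolding batch_grad_def using gs_measurable batch_less[OF that]
      by (intro borel_measurable_scaleR borel_measurable_const borel_measurable_sum
          measurable_compose[OF _ clip_borel_measurable]) auto
    show ?thesis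
      by measurable
  qed
  ultimately show "(\<lambda>x. emeasure (step x) A) \<in> borel_measurable borel"
    by simp
qed (auto simp: sets_step intro: prob_space_imp_subprob_space prob_space_step)

text \<open>Stated with nonnegative integrals because integrability of \<open>f\<close> after a step
  is not yet available at this point. The second claim ensures that \<open>ennreal r\<close> is not
  truncated to 0; it holds because \<open>r\<close> dominates the integral of a nonnegative
  function.\<close>

lemma nn_integral_gauss_shift_le:
  fixes g x :: 'a
  assumes g: "norm g \<le> c"
  defines "r \<equiv> f x - f0 - \<alpha> * inner (F x) g + noise_cost"
  shows "(\<integral>\<^sup>+z. ennreal (f (x - \<alpha> *\<^sub>R (g + z)) - f0) \<partial>gauss_vec \<sigma>) \<le> ennreal r" "0 \<le> r"
proof -
  \<comment> \<open>The descent lemma for the displacement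
    \<open>- \<alpha> *\<^sub>R (g + z)\<close>, sorted into parts constant, linear and quadratic in
    \<open>z\<close>; the linear part integrates to zero.\<close>
  let ?Q = "\<lambda>z. (f x - f0 - \<alpha> * inner (F x) g + G * \<alpha>\<^sup>2 / 2 * (norm g)\<^sup>2)
      + inner ((G * \<alpha>\<^sup>2) *\<^sub>R g - \<alpha> *\<^sub>R F x) z + G * \<alpha>\<^sup>2 / 2 * (norm z)\<^sup>2"
  interpret prob_space "gauss_vec \<sigma> :: 'a measure"
    by (rule prob_space_gauss_vec[OF \<sigma>])
  have le: "f (x - \<alpha> *\<^sub>R (g + z)) - f0 \<le> ?Q z" for z
  proof -
    have "f (x + - (\<alpha> *\<^sub>R (g + z))) \<le> f x + inner (F x) (- (\<alpha> *\<^sub>R (g + z)))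
        + G / 2 * (norm (- (\<alpha> *\<^sub>R (g + z))))\<^sup>2"
      by (rule descent_lemma[OF grad lip])
    moreover have "(norm (- (\<alpha> *\<^sub>R (g + z))))\<^sup>2 = \<alpha>\<^sup>2 * ((norm g)\<^sup>2 + 2 * inner g z + (norm z)\<^sup>2)"
      unfolding norm_minus_cancel norm_scaleR
      by (simp add: power_mult_distrib power2_norm_eq_inner inner_add_left inner_add_right
          inner_commute)
    ultimately have "f (x - \<alpha> *\<^sub>R (g + z)) \<le> f x - inner (F x) (\<alpha> *\<^sub>R (g + z))
        + G / 2 * (\<alpha>\<^sup>2 * ((norm g)\<^sup>2 + 2 * inner g z + (norm z)\<^sup>2))"
      by (simp only: inner_minus_right add_uminus_conv_diff)
    then show ?thesis
      by (simp add: inner_add_right inner_diff_left algebra_simps)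
  qed
  then have nonneg: "0 \<le> ?Q z" for z
    using f_ge[of "x - \<alpha> *\<^sub>R (g + z)"] by (meson diff_ge_0_iff_ge order_trans)
  have int: "integrable (gauss_vec \<sigma>) ?Q"
    by (intro Bochner_Integration.integrable_add integrable_const integrable_mult_right
        integrable_gauss_vec_inner integrable_gauss_vec_norm_sq \<sigma>)
  have "(\<integral>z. ?Q z \<partial>gauss_vec \<sigma>) = f x - f0 - \<alpha> * inner (F x) g + G * \<alpha>\<^sup>2 / 2 * (norm g)\<^sup>2
      + G * \<alpha>\<^sup>2 / 2 * (real DIM('a) * \<sigma>\<^sup>2)"
    using integrable_gauss_vec_inner[OF \<sigma>, of "(G * \<alpha>\<^sup>2) *\<^sub>R g - \<alpha> *\<^sub>R F x"]
      integrable_gauss_vec_norm_sq[OF \<sigma>, where 'a = 'a]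
    by (simp add: integral_gauss_vec_inner[OF \<sigma>] integral_gauss_vec_norm_sq[OF \<sigma>] prob_space)
  also have "\<dots> \<le> r"
  proof -
    have "G * \<alpha>\<^sup>2 / 2 * (norm g)\<^sup>2 \<le> G * \<alpha>\<^sup>2 / 2 * c\<^sup>2"
      using g G by (intro mult_left_mono power_mono) auto
    then show ?thesis
      by (simp add: r_def noise_cost_def algebra_simps)
  qed
  finally have r: "(\<integral>z. ?Q z \<partial>gauss_vec \<sigma>) \<le> r" .
  have "(\<integral>\<^sup>+z. ennreal (f (x - \<alpha> *\<^sub>R (g + z)) - f0) \<partial>gauss_vec \<sigma>) \<le> (\<integral>\<^sup>+z. ennreal (?Q z) \<partial>gauss_vec \<sigma>)"
    by (intro nn_integral_mono ennreal_leI le)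
  also have "\<dots> = ennreal (\<integral>z. ?Q z \<partial>gauss_vec \<sigma>)"
    by (rule nn_integral_eq_integral[OF int AE_I2[OF nonneg]])
  also have "\<dots> \<le> ennreal r"
    by (intro ennreal_leI r)
  finally show "(\<integral>\<^sup>+z. ennreal (f (x - \<alpha> *\<^sub>R (g + z)) - f0) \<partial>gauss_vec \<sigma>) \<le> ennreal r" .
  have "0 \<le> (\<integral>z. ?Q z \<partial>gauss_vec \<sigma>)"
    by (intro integral_nonneg_AE AE_I2 nonneg)
  then show "0 \<le> r"
    using r by linarith
qed

text \<open>The bound for a fixed batch is affine in the batch gradient, so averaging over batches
  just replaces that gradient by its mean.\<close>

lemma nn_integral_step_le:
  defines "r \<equiv> \<lambda>x. f x - f0 - \<alpha> * inner (F x) (mean_grad x) + noise_cost"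
  shows "(\<integral>\<^sup>+y. ennreal (f y - f0) \<partial>step x) \<le> ennreal (r x)" "0 \<le> r x"
proof -
  let ?r = "\<lambda>idx. f x - f0 - \<alpha> * inner (F x) (batch_grad idx x) + noise_cost"
  have [measurable_cong]: "sets (gauss_vec \<sigma> :: 'a measure) = sets borel"
    by (rule sets_gauss_vec[OF \<sigma>])
  have int: "integrable (measure_pmf batch) ?r"
    by (rule integrable_measure_pmf_finite[OF finite_set_batch])
  have nonneg: "0 \<le> ?r idx" for idx
    by (rule nn_integral_gauss_shift_le(2)[OF norm_batch_grad_le])
  have eq: "(\<integral>idx. ?r idx \<partial>measure_pmf batch) = r x"
    by (simp add: r_def integrable_measure_pmf_finite[OF finite_set_batch] integral_inner_batch_grad)
  have "(\<integral>\<^sup>+y. ennreal (f y - f0) \<partial>step x)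
      = (\<integral>\<^sup>+idx. \<integral>\<^sup>+z. ennreal (f (x - \<alpha> *\<^sub>R (batch_grad idx x + z)) - f0) \<partial>gauss_vec \<sigma> \<partial>measure_pmf batch)"
    unfolding step_eq
    by (subst nn_integral_bind[OF _ batch_kernel_measurable]) (auto simp: nn_integral_distr)
  also have "\<dots> \<le> (\<integral>\<^sup>+idx. ennreal (?r idx) \<partial>measure_pmf batch)"
    by (intro nn_integral_mono nn_integral_gauss_shift_le(1) norm_batch_grad_le)
  also have "\<dots> = ennreal (r x)"
    unfolding eq[symmetric] by (rule nn_integral_eq_integral[OF int AE_I2[OF nonneg]])
  finally show "(\<integral>\<^sup>+y. ennreal (f y - f0) \<partial>step x) \<le> ennreal (r x)" .
  show "0 \<le> r x"
    unfolding eq[symmetric] by (intro integral_nonneg_AE AE_I2 nonneg)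
qed

section \<open>Integrability and expected descent along the trajectory\<close>

lemma traj: "prob_space (traj x1 k) \<and> sets (traj x1 k) = sets borel"
proof (induction k)
  case 0
  then show ?case
    by (simp add: prob_space_return)
next
  case (Suc k)
  then interpret prob_space "traj x1 k" by simp
  have [measurable_cong]: "sets (traj x1 k) = sets borel"
    using Suc by simp
  show ?case
    by (auto intro!: prob_space_bind[where S = borel] sets_bind simp: prob_space_step sets_step not_empty)
qed

lemmas prob_space_traj = traj[THEN conjunct1] and sets_traj = traj[THEN conjunct2]

lemma nn_integral_traj_Suc:
  assumes "g \<in> borel_measurable borel"
  shows "(\<integral>\<^sup>+x. g x \<partial>traj x1 (Suc k)) = (\<integral>\<^sup>+x. \<integral>\<^sup>+y. g y \<partial>step x \<partial>traj x1 k)"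
proof -
  have [measurable_cong]: "sets (traj x1 k) = sets borel"
    by (rule sets_traj)
  show ?thesis
    using assms by (simp add: nn_integral_bind[where B = borel])
qed

lemma norm_F_sq_le: "(norm (F x))\<^sup>2 \<le> 2 * G * (f x - f0)"
  by (rule norm_gradient_sq_le[OF grad lip G f_ge])

text \<open>Linearises the squared bound through 2 y <= 1 + y^2, so that integrability of
  \<open>f\<close> passes to the gradient norm.\<close>

lemma norm_F_le: "norm (F x) \<le> 1 + 2 * G * (f x - f0)"
proof -
  have "0 \<le> (norm (F x) - 1)\<^sup>2"
    by simp
  then have "2 * norm (F x) \<le> 1 + (norm (F x))\<^sup>2"
    by (simp add: power2_eq_square algebra_simps)
  then show ?thesis
    using norm_F_sq_le[of x] norm_ge_zero[of "F x"] by linarith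
qed

lemma neg_inner_mean_grad_le: "- inner (F x) (mean_grad x) \<le> c * norm (F x)"
proof -
  have "- inner (F x) (mean_grad x) \<le> norm (F x) * norm (mean_grad x)"
    using Cauchy_Schwarz_ineq2[of "F x" "mean_grad x"] by linarith
  also have "\<dots> \<le> norm (F x) * c"
    by (intro mult_left_mono norm_mean_grad_le) simp
  finally show ?thesis
    by (simp add: mult.commute)
qed

text \<open>Induction: one step increases \<open>f x - f0\<close> in expectation to at most an
  affine function of itself, which is integrable by the induction hypothesis.\<close>

lemma integrable_f: "integrable (traj x1 k) (\<lambda>x. f x - f0)"
proof (induction k)
  case 0
  show ?case
    by (simp add: integrable_iff_bounded nn_integral_return)
next
  case (Suc k)
  have [measurable_cong]: "sets (traj x1 k) = sets borel" for k
    by (rule sets_traj)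
  interpret prob_space "traj x1 k"
    by (rule prob_space_traj)
  \<comment> \<open>The coefficients come from bounding \<open>- inner (F x) (mean_grad x)\<close>
    by \<open>c * norm (F x)\<close> and then applying \<open>norm_F_le\<close>.\<close>
  let ?b = "\<lambda>x. (1 + \<alpha> * c * (2 * G)) * (f x - f0) + (\<alpha> * c + noise_cost)"
  have int: "integrable (traj x1 k) ?b"
    using Suc by simp
  have nonneg: "0 \<le> ?b x" for x
    using f_ge[of x] \<alpha> c G noise_cost_nonneg by simp
  have "(\<integral>\<^sup>+x. ennreal (f x - f0) \<partial>traj x1 (Suc k)) \<le> (\<integral>\<^sup>+x. ennreal (?b x) \<partial>traj x1 k)"
  proof (subst nn_integral_traj_Suc, measurable, intro nn_integral_mono)
    fix x
    have "- inner (F x) (mean_grad x) \<le> c * (1 + 2 * G * (f x - f0))"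
      using neg_inner_mean_grad_le[of x] mult_left_mono[OF norm_F_le[of x], of c] c by linarith
    then have "\<alpha> * - inner (F x) (mean_grad x) \<le> \<alpha> * (c * (1 + 2 * G * (f x - f0)))"
      by (rule mult_left_mono[OF _ \<alpha>])
    then have "f x - f0 - \<alpha> * inner (F x) (mean_grad x) + noise_cost \<le> ?b x"
      by (simp add: algebra_simps)
    then show "(\<integral>\<^sup>+y. ennreal (f y - f0) \<partial>step x) \<le> ennreal (?b x)"
      using nn_integral_step_le(1)[of x] by (meson ennreal_leI order_trans)
  qed
  also have "\<dots> = ennreal (\<integral>x. ?b x \<partial>traj x1 k)"
    by (rule nn_integral_eq_integral[OF int AE_I2[OF nonneg]])
  finally have "(\<integral>\<^sup>+x. ennreal (f x - f0) \<partial>traj x1 (Suc k)) < \<infinity>"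
    by (simp add: le_less_trans[OF _ ennreal_less_top])
  then show ?case
    using f_ge by (intro integrableI_nonneg) (auto simp del: dpsgd_traj.simps)
qed

lemma integrable_norm_F: "integrable (traj x1 k) (\<lambda>x. norm (F x))"
proof -
  have [measurable_cong]: "sets (traj x1 k) = sets borel"
    by (rule sets_traj)
  interpret prob_space "traj x1 k"
    by (rule prob_space_traj)
  show ?thesis
    by (rule Bochner_Integration.integrable_bound[of _ "\<lambda>x. 1 + 2 * G * (f x - f0)"])
      (use norm_F_le in \<open>auto simp: integrable_f intro: order_trans[OF _ abs_ge_self]\<close>)
qed

text \<open>\<open>A\<close> stands for the stationarity measure and \<open>W\<close> for the
  Wasserstein correction. Keeping them abstract separates the trajectory argument from the pointwise
  inequality that relates them to the mean clipped gradient.\<close>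

lemma expectation_descent:
  assumes A [measurable]: "A \<in> borel_measurable borel" and W: "integrable (traj x1 k) W"
    and A_nonneg: "\<And>x. 0 \<le> A x"
    and AW: "\<And>x. A x - W x \<le> inner (F x) (mean_grad x)"
  shows "(\<integral>x. f x - f0 \<partial>traj x1 (Suc k)) + \<alpha> * (\<integral>x. A x \<partial>traj x1 k)
    \<le> (\<integral>x. f x - f0 \<partial>traj x1 k) + \<alpha> * (\<integral>x. W x \<partial>traj x1 k) + noise_cost"
proof -
  have [measurable_cong]: "sets (traj x1 k) = sets borel" for k
    by (rule sets_traj)
  interpret prob_space "traj x1 k"
    by (rule prob_space_traj)
  \<comment> \<open>Integrability of \<open>A\<close> is inherited: it is nonnegative and at most
    \<open>W x + c * norm (F x)\<close>.\<close>
  have intA: "integrable (traj x1 k) A"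
  proof (rule Bochner_Integration.integrable_bound[of _ "\<lambda>x. W x + c * norm (F x)"])
    show "AE x in traj x1 k. norm (A x) \<le> norm (W x + c * norm (F x))"
    proof (rule AE_I2)
      fix x
      have "inner (F x) (mean_grad x) \<le> norm (F x) * norm (mean_grad x)"
        by (rule norm_cauchy_schwarz)
      also have "\<dots> \<le> norm (F x) * c"
        by (intro mult_left_mono norm_mean_grad_le) simp
      finally show "norm (A x) \<le> norm (W x + c * norm (F x))"
        using AW[of x] A_nonneg[of x] by (simp add: mult.commute)
    qed
  qed (use W in \<open>simp_all add: integrable_norm_F\<close>)
  let ?b = "\<lambda>x. f x - f0 - \<alpha> * A x + \<alpha> * W x + noise_cost"
  have int: "integrable (traj x1 k) ?b"
    using intA W by (intro Bochner_Integration.integrable_add Bochner_Integration.integrable_diff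
        integrable_mult_right integrable_const integrable_f)
  have b: "f x - f0 - \<alpha> * inner (F x) (mean_grad x) + noise_cost \<le> ?b x" for x
    using mult_left_mono[OF AW \<alpha>, of x] by (simp add: algebra_simps)
  then have nonneg: "0 \<le> ?b x" for x
    using nn_integral_step_le(2)[of x] order_trans by blast
  have "ennreal (\<integral>x. f x - f0 \<partial>traj x1 (Suc k)) = (\<integral>\<^sup>+x. ennreal (f x - f0) \<partial>traj x1 (Suc k))"
    by (rule nn_integral_eq_integral[symmetric, OF integrable_f]) (simp add: f_ge)
  also have "\<dots> \<le> (\<integral>\<^sup>+x. ennreal (?b x) \<partial>traj x1 k)"
    by (subst nn_integral_traj_Suc, measurable, intro nn_integral_mono
        order_trans[OF nn_integral_step_le(1) ennreal_leI[OF b]])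
  also have "\<dots> = ennreal (\<integral>x. ?b x \<partial>traj x1 k)"
    by (rule nn_integral_eq_integral[OF int AE_I2[OF nonneg]])
  finally have "(\<integral>x. f x - f0 \<partial>traj x1 (Suc k)) \<le> (\<integral>x. ?b x \<partial>traj x1 k)"
    by (subst (asm) ennreal_le_iff) (auto intro!: integral_nonneg_AE simp: nonneg)
  also have "\<dots> = (\<integral>x. f x - f0 - \<alpha> * A x \<partial>traj x1 k) + \<alpha> * (\<integral>x. W x \<partial>traj x1 k) + noise_cost"
    using intA W integrable_f[of x1 k]
    by (simp add: prob_space del: Bochner_Integration.integral_diff)
  also have "(\<integral>x. f x - f0 - \<alpha> * A x \<partial>traj x1 k)
      = (\<integral>x. f x - f0 \<partial>traj x1 k) - \<alpha> * (\<integral>x. A x \<partial>traj x1 k)"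
    by (subst Bochner_Integration.integral_diff[OF integrable_f integrable_mult_right[OF intA]]) simp
  finally show ?thesis
    by simp
qed

end

section \<open>Empirical noise and the balance of parameters\<close>

lemma prob_space_emp_noise: "prob_space (emp_noise gs F n x)"
  and sets_emp_noise: "sets (emp_noise gs F n x) = sets borel"
  unfolding emp_noise_def by (simp_all add: measure_pmf.prob_space_distr)

lemma integral_emp_noise:
  fixes gs :: "nat \<Rightarrow> 'a::euclidean_space \<Rightarrow> 'a"
  assumes "1 \<le> n"
  shows "(\<integral>\<xi>. inner w (clip (F x + \<xi>) c) \<partial>emp_noise gs F n x)
    = inner w ((1 / real n) *\<^sub>R (\<Sum>i<n. clip (gs i x) c))"
  unfolding emp_noise_def using assms
  by (subst integral_distr) (auto simp: integral_pmf_of_set inner_sum_right lessThan_empty_iff)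

text \<open>Chains the symmetric bound with the cost of changing the noise law; the empirical
  expectation left over is the mean clipped gradient.\<close>

lemma symmetric_bound_minus_Wdist_le:
  fixes gs :: "nat \<Rightarrow> 'a::euclidean_space \<Rightarrow> 'a"
  assumes n: "1 \<le> n" and c: "0 < c" and p: "prob_space p" "sets p = sets borel"
    and sym: "distr p borel uminus = p"
  shows "measure p {\<xi>. norm \<xi> < c / 4} * hc c (norm (F x)) - Wdist (F x) c p (emp_noise gs F n x)
    \<le> inner (F x) ((1 / real n) *\<^sub>R (\<Sum>i<n. clip (gs i x) c))"
proof -
  have "couplings p (emp_noise gs F n x) \<noteq> {}"
    using pair_measure_in_couplings[OF p(1) prob_space_emp_noise p(2) sets_emp_noise] by blast
  from integral_diff_le_Wdist[OF less_imp_le[OF c] this, of "F x"]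
    symmetric_clip_bound[OF c p sym, of "F x"]
  show ?thesis
    unfolding integral_emp_noise[OF n] by linarith
qed

text \<open>With this step size the initial gap \<open>Df / (\<alpha> * T)\<close> contributes one
  unit of c sqrt(Df G d L) / (n \<epsilon>), and the second-order term contributes (1 + v) / 2
  units. Their sum is v / 2 + 3 / 2.\<close>

lemma learning_rate_balance:
  fixes Df G c L d n \<epsilon> v T \<alpha> \<sigma> :: real
  assumes pos: "0 < Df" "0 < G" "0 < c" "0 < L" "0 < d" "0 < n" "0 < \<epsilon>"
    and T: "T = n\<^sup>2 * \<epsilon>\<^sup>2 / (d * L)" and \<alpha>: "\<alpha> = sqrt (Df * d * L) / (n * \<epsilon> * c * sqrt G)"
    and \<sigma>: "d * \<sigma>\<^sup>2 = v * c\<^sup>2"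
  shows "(Df + T * (G * \<alpha>\<^sup>2 / 2 * (c\<^sup>2 + d * \<sigma>\<^sup>2))) / (\<alpha> * T)
    = (v / 2 + 3 / 2) * c * sqrt (Df * G * d * L) / (n * \<epsilon>)"
proof -
  define R where "R = sqrt (Df * d * L)"
  define g where "g = sqrt G"
  have R: "0 < R" "R\<^sup>2 = Df * d * L" and g: "0 < g" "G = g\<^sup>2"
    using pos by (auto simp: R_def g_def)
  have sq: "sqrt (Df * G * d * L) = R * g"
    by (simp add: R_def g_def real_sqrt_mult)
  have \<alpha>': "\<alpha> = R / (n * \<epsilon> * c * g)"
    by (simp add: \<alpha> R_def g_def)
  then have "0 < \<alpha>" "0 < T"
    using pos R g by (simp_all add: T)
  then have "(Df + T * (G * \<alpha>\<^sup>2 / 2 * (c\<^sup>2 + d * \<sigma>\<^sup>2))) / (\<alpha> * T)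
      = Df / (\<alpha> * T) + G * \<alpha> / 2 * (c\<^sup>2 * (1 + v))"
    unfolding \<sigma> by (simp add: field_simps power2_eq_square)
  also have "Df / (\<alpha> * T) = (Df * d * L) * (c * g) / (R * (n * \<epsilon>))"
    using pos R g by (simp add: \<alpha>' T field_simps power2_eq_square)
  also have "\<dots> = c * (R * g) / (n * \<epsilon>)"
    using pos R(1) unfolding R(2)[symmetric] by (simp add: power2_eq_square field_simps)
  also have "G * \<alpha> / 2 * (c\<^sup>2 * (1 + v)) = (v / 2 + 1 / 2) * c * (R * g) / (n * \<epsilon>)"
    using pos g by (simp add: \<alpha>' power2_eq_square field_simps)
  also have "c * (R * g) / (n * \<epsilon>) + (v / 2 + 1 / 2) * c * (R * g) / (n * \<epsilon>)
      = (v / 2 + 3 / 2) * c * (R * g) / (n * \<epsilon>)"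
    using pos by (simp add: field_simps)
  finally show ?thesis
    unfolding sq .
qed

section \<open>The averaged utility bound\<close>

theorem theorem5:
  shows "\<exists>u::real>0. \<exists>v::real>0. \<forall>(n::nat) (m::nat) (fs::nat \<Rightarrow> 'a::euclidean_space \<Rightarrow> real)
      (gs::nat \<Rightarrow> 'a \<Rightarrow> 'a) (f::'a \<Rightarrow> real) (F::'a \<Rightarrow> 'a) (G::real) (Df::real) (x1::'a)
      (c::real) (\<epsilon>::real) (\<delta>::real) (T::nat) (\<alpha>::real) (\<sigma>::real) (pt::nat \<Rightarrow> 'a \<Rightarrow> 'a measure).
    ( 1 \<le> m \<and> m \<le> n
    \<and> (\<forall>x. f x = (\<Sum>i<n. fs i x) / real n)
    \<and> (\<forall>i<n. \<forall>x. GDERIV (fs i) x :> gs i x)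
    \<and> (\<forall>x. GDERIV f x :> F x)
    \<and> G > 0 \<and> (\<forall>x y. norm (F x - F y) \<le> G * norm (x - y))
    \<and> (\<exists>xs. (\<forall>x. f xs \<le> f x) \<and> f x1 - f xs \<le> Df)
    \<and> c > 0 \<and> \<epsilon> > 0 \<and> 0 < \<delta> \<and> \<delta> < 1
    \<and> real T = real n ^ 2 * \<epsilon> ^ 2 / (real DIM('a) * ln (1 / \<delta>))
    \<and> \<epsilon> \<le> u * real m ^ 2 / real n ^ 2 * real T
    \<and> \<sigma> = sqrt (v * c ^ 2 * real T * ln (1 / \<delta>) / (real n ^ 2 * \<epsilon> ^ 2))
    \<and> \<alpha> = sqrt (Df * real DIM('a) * ln (1 / \<delta>)) / (real n * \<epsilon> * c * sqrt G)
    \<and> (\<forall>t x. prob_space (pt t x) \<and> sets (pt t x) = sets borel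
              \<and> distr (pt t x) borel uminus = pt t x)
    \<and> (\<forall>t. (\<lambda>x. measure (pt t x) {\<xi>. norm \<xi> < c / 4}) \<in> borel_measurable borel)
    \<and> (\<forall>t. (\<lambda>x. Wdist (F x) c (pt t x) (emp_noise gs F n x)) \<in> borel_measurable borel) )
    \<longrightarrow>
    (1 / real T) * (\<Sum>t=1..T. \<integral>x. measure (pt t x) {\<xi>. norm \<xi> < c / 4} * hc c (norm (F x))
                                  \<partial>(dpsgd_traj gs F n m c \<alpha> \<sigma> x1 (t - 1)))
    \<le> (v / 2 + 3 / 2) * c * sqrt (Df * G * real DIM('a) * ln (1 / \<delta>)) / (real n * \<epsilon>)
      + (1 / real T) * (\<Sum>t=1..T. \<integral>x. Wdist (F x) c (pt t x) (emp_noise gs F n x)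
                                  \<partial>(dpsgd_traj gs F n m c \<alpha> \<sigma> x1 (t - 1)))"
proof (rule exI[of _ 1], intro conjI zero_less_one exI[of _ 1] allI impI; (elim conjE)?)
  fix n m :: nat and fs :: "nat \<Rightarrow> 'a \<Rightarrow> real" and gs :: "nat \<Rightarrow> 'a \<Rightarrow> 'a" and f :: "'a \<Rightarrow> real"
    and F :: "'a \<Rightarrow> 'a" and G Df :: real and x1 :: 'a and c \<epsilon> \<delta> :: real and T :: nat
    and \<alpha> \<sigma> :: real and pt :: "nat \<Rightarrow> 'a \<Rightarrow> 'a measure"
  assume m: "1 \<le> m" and mn: "m \<le> n"
    and gs: "\<forall>i<n. \<forall>x. GDERIV (fs i) x :> gs i x"
    and grad: "\<forall>x. GDERIV f x :> F x"
    and G: "G > 0" and lip: "\<forall>x y. norm (F x - F y) \<le> G * norm (x - y)"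
    and min: "\<exists>xs. (\<forall>x. f xs \<le> f x) \<and> f x1 - f xs \<le> Df"
    and c: "c > 0" and \<epsilon>: "\<epsilon> > 0" and \<delta>: "0 < \<delta>" "\<delta> < 1"
    and T_eq: "real T = real n ^ 2 * \<epsilon> ^ 2 / (real DIM('a) * ln (1 / \<delta>))"
    and \<sigma>_eq: "\<sigma> = sqrt (1 * c ^ 2 * real T * ln (1 / \<delta>) / (real n ^ 2 * \<epsilon> ^ 2))"
    and \<alpha>_eq: "\<alpha> = sqrt (Df * real DIM('a) * ln (1 / \<delta>)) / (real n * \<epsilon> * c * sqrt G)"
    and pt: "\<forall>t x. prob_space (pt t x) \<and> sets (pt t x) = sets borel \<and> distr (pt t x) borel uminus = pt t x"
    and pt_meas: "\<forall>t. (\<lambda>x. measure (pt t x) {\<xi>. norm \<xi> < c / 4}) \<in> borel_measurable borel"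
    and W_meas: "\<forall>t. (\<lambda>x. Wdist (F x) c (pt t x) (emp_noise gs F n x)) \<in> borel_measurable borel"
  obtain xs where xs: "\<And>x. f xs \<le> f x" "f x1 - f xs \<le> Df"
    using min by auto
  define L where "L = ln (1 / \<delta>)"
  have n_pos: "1 \<le> n" "0 < real n" and L: "0 < L" and d: "0 < real DIM('a)"
    using m mn \<delta> by (auto simp: L_def)
  have T_pos: "0 < real T"
    unfolding T_eq using n_pos \<epsilon> L d by (simp add: L_def)
  \<comment> \<open>Inserting \<open>T\<close> cancels \<open>n\<close>, \<open>\<epsilon>\<close>
    and the logarithm, so the total noise variance \<open>DIM('a) * \<sigma>\<^sup>2\<close> is just
    \<open>c\<^sup>2\<close>.\<close>
  have \<sigma>_sq: "\<sigma>\<^sup>2 = c\<^sup>2 / real DIM('a)"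
    unfolding \<sigma>_eq using n_pos \<epsilon> L d by (simp add: T_eq L_def[symmetric])
  have "0 < \<sigma>"
    unfolding \<sigma>_eq using n_pos \<epsilon> L d c T_pos by (simp add: L_def[symmetric])
  have Df: "0 \<le> Df"
    using xs by (smt (verit))
  have \<alpha>_nonneg: "0 \<le> \<alpha>"
    unfolding \<alpha>_eq using n_pos \<epsilon> L c G Df by (simp add: L_def[symmetric])
  \<comment> \<open>The locale asks only for \<open>0 \<le> \<alpha>\<close>, so it also covers
    \<open>Df = 0\<close>, where the step size vanishes.\<close>
  interpret dpsgd n m gs f F G c \<alpha> \<sigma> "f xs"
  proof
    show "gs i \<in> borel_measurable borel" if "i < n" for i
      using GDERIV_borel_measurable(2)[of "fs i" "gs i"] gs that by blast
  qed (use n_pos m grad lip xs G c \<alpha>_nonneg \<open>0 < \<sigma>\<close> in auto)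
  \<comment> \<open>Index shift: \<open>traj x1 k\<close> is the law of the iterate numbered
    \<open>Suc k\<close>, so it is paired with \<open>pt (Suc k)\<close>; the sum over t = 1..T
    becomes one over k < T.\<close>
  define A where "A k x = measure (pt (Suc k) x) {\<xi>. norm \<xi> < c / 4} * hc c (norm (F x))" for k x
  define W where "W k x = Wdist (F x) c (pt (Suc k) x) (emp_noise gs F n x)" for k x
  define V where "V k = (\<integral>x. f x - f xs \<partial>traj x1 k)" for k
  define EA where "EA k = (\<integral>x. A k x \<partial>traj x1 k)" for k
  define EW where "EW k = (\<integral>x. W k x \<partial>traj x1 k)" for k
  have couplings: "couplings (pt t x) (emp_noise gs F n x) \<noteq> {}" for t x
    using pair_measure_in_couplings[OF _ prob_space_emp_noise _ sets_emp_noise, of "pt t x"] pt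
    by blast
  have A_meas: "A k \<in> borel_measurable borel" for k
  proof -
    have [measurable]: "(\<lambda>x. measure (pt (Suc k) x) {\<xi>. norm \<xi> < c / 4}) \<in> borel_measurable borel"
      using pt_meas by blast
    show ?thesis
      unfolding A_def hc_def by measurable
  qed
  have A_nonneg: "0 \<le> A k x" for k x
    using c by (simp add: A_def hc_nonneg)
  have W_nonneg: "0 \<le> W k x" for k x
    unfolding W_def by (rule Wdist_nonneg[OF couplings])
  have W_int: "integrable (traj x1 k) (W k)" for k
  proof (rule Bochner_Integration.integrable_bound[of _ "\<lambda>x. 2 * c * norm (F x)"])
    show "integrable (traj x1 k) (\<lambda>x. 2 * c * norm (F x))"
      by (intro integrable_mult_right integrable_norm_F)
    show "W k \<in> borel_measurable (traj x1 k)"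
      using W_meas unfolding W_def by (simp add: measurable_cong_sets[OF sets_traj refl])
    show "AE x in traj x1 k. norm (W k x) \<le> norm (2 * c * norm (F x))"
      using W_nonneg Wdist_le[OF _ couplings] c by (auto simp: W_def)
  qed
  have AW: "A k x - W k x \<le> inner (F x) (mean_grad x)" for k x
    unfolding A_def W_def mean_grad_def
    by (rule symmetric_bound_minus_Wdist_le) (use n c pt in auto)
  have descent: "V (Suc k) + \<alpha> * EA k \<le> V k + \<alpha> * EW k + noise_cost" for k
    unfolding V_def EA_def EW_def
    by (rule expectation_descent[OF A_meas W_int A_nonneg AW])
  have V_nonneg: "0 \<le> V k" for k
    unfolding V_def by (intro integral_nonneg_AE) (simp add: xs)
  have V0: "V 0 \<le> Df"
    unfolding V_def using xs by (simp add: integral_return)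
  have EW_nonneg: "0 \<le> EW k" for k
    unfolding EW_def by (intro integral_nonneg_AE) (simp add: W_nonneg)
  have bound: "(1 / real T) * (\<Sum>k<T. EA k)
    \<le> (1 / 2 + 3 / 2) * c * sqrt (Df * G * real DIM('a) * L) / (real n * \<epsilon>) + (1 / real T) * (\<Sum>k<T. EW k)"
  proof (cases "Df = 0")
    case True
    \<comment> \<open>Here \<open>\<alpha> = 0\<close>, so the averaged descent inequality carries no information; instead the
      trajectory stays almost surely among the minimisers.\<close>
    then have "\<alpha> = 0"
      by (simp add: \<alpha>_eq)
    moreover from this have "noise_cost = 0"
      unfolding noise_cost_def by simp
    ultimately have "V (Suc k) \<le> V k" for k
      using descent[of k] by simp
    then have V: "V k \<le> 0" for k
      using V0 True by (induction k) (auto intro: order_trans)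
    have "EA k \<le> 0" for k
    proof -
      \<comment> \<open>This ties the measured quantity to the optimality gap: the probability is at
        most 1 and \<open>hc\<close> is at most the squared gradient norm. Since the mean gap
        \<open>V k\<close> is not positive, neither is \<open>EA k\<close>.\<close>
      have "A k x \<le> 2 * G * (f x - f xs)" for x
      proof -
        interpret p: prob_space "pt (Suc k) x"
          using pt by blast
        have "A k x \<le> 1 * hc c (norm (F x))"
          unfolding A_def using c by (intro mult_right_mono p.prob_le_1 hc_nonneg) auto
        also have "\<dots> \<le> (norm (F x))\<^sup>2"
          by (simp add: hc_def)
        also have "\<dots> \<le> 2 * G * (f x - f xs)"
          by (rule norm_F_sq_le)
        finally show ?thesis .
      qed
      then have "EA k \<le> (\<integral>x. 2 * G * (f x - f xs) \<partial>traj x1 k)"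
        unfolding EA_def
        by (intro integral_mono_AE' AE_I2 integrable_mult_right integrable_f)
          (simp_all add: xs less_imp_le G)
      also have "\<dots> = 2 * G * V k"
        by (simp add: V_def)
      also have "\<dots> \<le> 0"
        using V[of k] G by (simp add: mult_nonneg_nonpos)
      finally show ?thesis .
    qed
    then have "(1 / real T) * (\<Sum>k<T. EA k) \<le> 0"
      by (intro mult_nonneg_nonpos sum_nonpos) auto
    moreover have "0 \<le> (1 / real T) * (\<Sum>k<T. EW k)"
      by (intro mult_nonneg_nonneg sum_nonneg EW_nonneg) auto
    ultimately show ?thesis
      using True by simp
  next
    case False
    then have "0 < Df"
      using Df by simp
    then have \<alpha>_pos: "0 < \<alpha>"
      unfolding \<alpha>_eq using n_pos \<epsilon> L c G d by (simp add: L_def[symmetric])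
    \<comment> \<open>Telescoped descent. Afterwards the final gap \<open>V T\<close> is dropped as
      nonnegative and the sum is divided by \<open>\<alpha> * real T\<close>.\<close>
    have "V K + \<alpha> * (\<Sum>k<K. EA k) \<le> V 0 + \<alpha> * (\<Sum>k<K. EW k) + real K * noise_cost" for K
    proof (induction K)
      case (Suc K)
      then show ?case
        using descent[of K] by (simp add: algebra_simps)
    qed simp
    from this[of T] have "\<alpha> * (\<Sum>k<T. EA k) \<le> Df + real T * noise_cost + \<alpha> * (\<Sum>k<T. EW k)"
      using V_nonneg[of T] V0 by linarith
    then have "(1 / real T) * (\<Sum>k<T. EA k)
        \<le> (Df + real T * noise_cost) / (\<alpha> * real T) + (1 / real T) * (\<Sum>k<T. EW k)"
      using \<alpha>_pos T_pos by (simp add: field_simps)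
    also have "(Df + real T * noise_cost) / (\<alpha> * real T)
        = (1 / 2 + 3 / 2) * c * sqrt (Df * G * real DIM('a) * L) / (real n * \<epsilon>)"
      unfolding noise_cost_def
      by (rule learning_rate_balance)
        (use \<open>0 < Df\<close> G c L d n_pos \<epsilon> T_eq \<alpha>_eq \<sigma>_sq in \<open>auto simp: L_def\<close>)
    finally show ?thesis .
  qed
  then show "(1 / real T) * (\<Sum>t=1..T. \<integral>x. measure (pt t x) {\<xi>. norm \<xi> < c / 4} * hc c (norm (F x))
        \<partial>(dpsgd_traj gs F n m c \<alpha> \<sigma> x1 (t - 1)))
    \<le> (1 / 2 + 3 / 2) * c * sqrt (Df * G * real DIM('a) * ln (1 / \<delta>)) / (real n * \<epsilon>)
      + (1 / real T) * (\<Sum>t=1..T. \<integral>x. Wdist (F x) c (pt t x) (emp_noise gs F n x)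
        \<partial>(dpsgd_traj gs F n m c \<alpha> \<sigma> x1 (t - 1)))"
    by (simp add: sum.atLeast1_atMost_eq EA_def EW_def A_def W_def L_def)
qed

end
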